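(* On $E_4:\ w^2=p(1+22p-7p^2)$ let $F_5=1-2w-16p+7p^2$, $F_6=1-10w+47p+2wp-17p^2+p^3$, $\widetilde F_6=1+10w+47p-2wp-17p^2+p^3$, $G_5=1+47w+89p-14wp+91p^2-49wp^2-245p^3$ and $\Phi_4=\dfrac{512(w-4p)F_5^7}{(1+w+3p)G_5^4}$. Then near $(p,w)=(0,0)$ on $E_4$, with branches chosen so that each right-hand side is holomorphic at $(0,0)$ with value $1$: $${}_3F_2\!\left(-\tfrac3{28},\tfrac{11}{28},\tfrac9{14};\tfrac47,\tfrac67;\Phi_4\right)=\frac{(1-7w-21p)(1-p)^{6/7}F_6^{3/14}}{(1-w+3p)G_5^{3/7}},$$ $${}_3F_2\!\left(\tfrac1{28},\tfrac{15}{28},\tfrac{11}{14};\tfrac57,\tfrac87;\Phi_4\right)=\frac{(1-\frac73p)(1-p)^{2/7}\widetilde F_6^{1/14}G_5^{1/7}}{F_5},$$ $${}_3F_2\!\left(\tfrac9{28},\tfrac{23}{28},\tfrac{15}{14};\tfrac97,\tfrac{10}7;\Phi_4\right)=\frac{(1+7w-21p)\sqrt p\,(1-p)^{4/7}\widetilde F_6^{1/7}G_5^{9/7}}{(w-4p)F_5^3}.$$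
   Context: ${}_3F_2(\alpha_1,\alpha_2,\alpha_3;\beta_1,\beta_2;z)=\sum_{n\ge0}\frac{(\alpha_1)_n(\alpha_2)_n(\alpha_3)_n}{(\beta_1)_n(\beta_2)_n n!}z^n$. A local parameter of $E_4$ at $(0,0)$ is $\sqrt p$ (equivalently $w$). *)

theory Defs
  imports "HOL-Analysis.Analysis"
begin

definition hyp3F2 :: "complex \<Rightarrow> complex \<Rightarrow> complex \<Rightarrow> complex \<Rightarrow> complex \<Rightarrow> complex \<Rightarrow> complex" where
  "hyp3F2 a1 a2 a3 b1 b2 z =
     (\<Sum>n. pochhammer a1 n * pochhammer a2 n * pochhammer a3 n
           / (pochhammer b1 n * pochhammer b2 n * fact n) * z ^ n)"

definition F5 :: "complex \<Rightarrow> complex \<Rightarrow> complex" where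
  "F5 p w = 1 - 2*w - 16*p + 7*p^2"

definition F6 :: "complex \<Rightarrow> complex \<Rightarrow> complex" where
  "F6 p w = 1 - 10*w + 47*p + 2*w*p - 17*p^2 + p^3"

definition F6t :: "complex \<Rightarrow> complex \<Rightarrow> complex" where
  "F6t p w = 1 + 10*w + 47*p - 2*w*p - 17*p^2 + p^3"

definition G5 :: "complex \<Rightarrow> complex \<Rightarrow> complex" where
  "G5 p w = 1 + 47*w + 89*p - 14*w*p + 91*p^2 - 49*w*p^2 - 245*p^3"

definition Phi4 :: "complex \<Rightarrow> complex \<Rightarrow> complex" where
  "Phi4 p w = 512 * (w - 4*p) * F5 p w ^ 7 / ((1 + w + 3*p) * G5 p w ^ 4)"

text \<open>Local parametrisation of E4: w^2 = p(1+22p-7p^2) near (0,0) by the local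
  parameter t = sqrt p: p = t^2, w = t * sqrt(1+22t^2-7t^4) (principal root, value 1 at t=0).\<close>
definition E4p :: "complex \<Rightarrow> complex" where
  "E4p t = t^2"

definition E4w :: "complex \<Rightarrow> complex" where
  "E4w t = t * csqrt (1 + 22*t^2 - 7*t^4)"

end

theory Submission
  imports Defs "HOL-Complex_Analysis.Complex_Analysis"
begin

text \<open>
  Put $s = \surd(1 + 22 t^2 - 7 t^4)$ and let $D = s\,d/dt$, the invariant derivation of $E_4$, so that
  $Dp = 2w$ and $Dw = 1 + 44 p - 21 p^2$. The map $\Phi_4$ has degree 24 and is branched only over
  0 (orders 1, 7), $\infty$ (order 4) and 1 (order 2); this shows up as $D\Phi/\Phi = U/N$ with
  $N = p(1-p)F_5G_5$ and $p\,G_5^4(1-\Phi) = U^2$. Since the local exponents $0, 1/2, 1$ at $\Phi = 1$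
  become $0, 1, 2$ upstairs, the factor $U$ cancels when the hypergeometric equation is pulled back, leaving
  a third-order equation in $D$ with singularities only at the zeros of $N$. Each right-hand side has
  the form $z\cdot S$ with $z$ a polynomial in $p, w$ and $DS/S$ rational with denominator $N$, so
  that it solves the pulled-back equation by a polynomial identity modulo the curve equation.
  Finally, $\Phi$ is a local coordinate at $t = 0$, and the exponents $0, 1-\beta_1, 1-\beta_2$ there
  leave only one holomorphic solution with value 1.
\<close>

subsection \<open>The coordinate ring of the curve\<close>

text \<open>The element \<open>CP A B\<close> stands for the function $A(p) + B(p)\,w$ on $E_4$.\<close>
datatype curve_poly = CP (const_part: "complex poly") (w_part: "complex poly")

text \<open>The product reduces w^2 by the curve equation at once, so an identity modulo that
  equation becomes a literal equality of coefficient lists, which expansion decides.\<close>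

instantiation curve_poly :: comm_ring_1
begin

definition "0 = CP 0 0"
definition "1 = CP 1 0"
definition "x + y = CP (const_part x + const_part y) (w_part x + w_part y)"
definition "- x = CP (- const_part x) (- w_part x)"
definition "x - y = CP (const_part x - const_part y) (w_part x - w_part y)"
definition "x * y = CP (const_part x * const_part y + [:0, 1, 22, -7:] * (w_part x * w_part y))
                       (const_part x * w_part y + w_part x * const_part y)"

instance
  by standard
     (auto simp: zero_curve_poly_def one_curve_poly_def plus_curve_poly_def uminus_curve_poly_def
        minus_curve_poly_def times_curve_poly_def curve_poly.expand algebra_simps
        simp del: mult_pCons_left mult_pCons_right)

end

lemma CP_arith:
  "CP a b + CP c d = CP (a + c) (b + d)"
  "CP a b - CP c d = CP (a - c) (b - d)"
  "- CP a b = CP (- a) (- b)"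
  "CP a b * CP c d = CP (a * c + [:0, 1, 22, -7:] * (b * d)) (a * d + b * c)"
  by (simp_all add: plus_curve_poly_def uminus_curve_poly_def minus_curve_poly_def times_curve_poly_def)

lemma one_CP: "1 = CP [:1:] 0"
  by (simp add: one_curve_poly_def one_pCons)

definition cst :: "complex \<Rightarrow> curve_poly" where "cst c = CP [:c:] 0"

text \<open>Write c for the cubic with w^2 = c(p). The formula is forced by Dp = 2w and Dw = c'(p);
  its first summand is 2 w^2 B'(p), reduced by the curve equation.\<close>

definition \<D> :: "curve_poly \<Rightarrow> curve_poly" where
  "\<D> x = CP (smult 2 ([:0, 1, 22, -7:] * pderiv (w_part x)) + [:1, 44, -21:] * w_part x)
            (smult 2 (pderiv (const_part x)))"

lemma smult_two_eq_add: "smult 2 x = x + x" for x :: "complex poly"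
  using smult_add_left[of 1 1 x] by simp

text \<open>The product rule holds because 2 w Dw = D(c(p)), so \<open>\<D>\<close> respects the
  relation w^2 = c(p).\<close>

lemma derivation_rules:
  "\<D> (x - y) = \<D> x - \<D> y" "\<D> (x * y) = \<D> x * y + x * \<D> y"
proof -
  show "\<D> (x - y) = \<D> x - \<D> y"
    by (simp add: \<D>_def minus_curve_poly_def pderiv_diff smult_diff_right algebra_simps
        del: mult_pCons_left mult_pCons_right)
  \<comment> \<open>The cubic is kept opaque; all that matters is that its derivative is
    \<open>c'\<close>.\<close>
  define c c' where "c = [:0, 1, 22, -7 :: complex:]" and "c' = [:1, 44, -21 :: complex:]"
  have c: "pderiv c = c'"
    by (simp add: c_def c'_def pderiv_pCons)
  show "\<D> (x * y) = \<D> x * y + x * \<D> y"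
    unfolding \<D>_def times_curve_poly_def plus_curve_poly_def curve_poly.sel c_def [symmetric] c'_def [symmetric]
    by (simp add: pderiv_mult pderiv_add c smult_two_eq_add algebra_simps)
qed

section \<open>Explicit functions on the curve and the ramification of the covering\<close>

definition "xp = CP [:0, 1:] 0"
definition "xw = CP 0 [:1:]"
definition "f5 = CP [:1, -16, 7:] [:-2:]"
definition "f6 = CP [:1, 47, -17, 1:] [:-10, 2:]"
definition "f6t = CP [:1, 47, -17, 1:] [:10, -2:]"
definition "g5 = CP [:1, 89, 91, -245:] [:47, -14, -49:]"

text \<open>\<open>U_num / U_den\<close> and \<open>cden_log / U_den\<close> are the logarithmic derivatives of $\Phi_4$ and \<open>cden\<close>, and
  $1 - \Phi_4$ = \<open>U_num\<^sup>2 / cden\<close>.\<close>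
definition "U_den = CP [:0, 1, -22, -3345, 3660, 6223, -8918, 2401:]
                    [:0, 45, -989, 1266, 854, -1519, 343:]"
definition "U_num = CP [:0, -162, -15716, -90350, 318536, -529886, 352604, -43218:]
                    [:1, -1464, -20095, 52312, -79597, 42336, 4459:]"
definition "\<Lambda> = CP [:-1, -1478, 11006, 1243010, 2229996, -27705426, 41890002, -19286890, 2701125:]
                  [:-444, -22102, 403616, 193822, -5417804, 8069222, -3460184, 504210:]"
definition "cden = xp * g5^4"
definition "cden_log = (1 - xp) * f5 * (cst 2 * xw * g5 + cst 4 * xp * \<D> g5)"

lemmas CP_defs = zero_curve_poly_def one_CP cst_def xp_def xw_def f5_def f6_def f6t_def g5_def U_den_def U_num_def
  \<Lambda>_def cden_def cden_log_def
lemmas CP_eval = CP_arith \<D>_def power_numeral_even power_numeral_odd Let_def pderiv_pCons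

lemma U_den_eq: "U_den = xp * (1 - xp) * f5 * g5"
  by (simp add: CP_defs CP_eval)

text \<open>This is 1 - \<Phi> = U^2 / \<open>cden\<close> with denominators cleared; the square
  expresses ramification of order 2 over 1.\<close>

lemma U_num_square: "(1 + xw + cst 3 * xp) * (cden - U_num\<^sup>2) = cst 512 * xp * (xw - cst 4 * xp) * f5 ^ 7"
  by (simp add: CP_defs CP_eval)

text \<open>With u = w - 4p and v = 1 + w + 3p, the bracket is u v f5 g5 times the logarithmic
  derivative of u f5^7 / (v g5^4). The identity thus says D\<Phi>/\<Phi> = \<open>U_num\<close> /
  \<open>U_den\<close>.\<close>

lemma U_num_logderiv:
  "xp * (1 - xp) * ((\<D> (xw - cst 4 * xp) * f5 + cst 7 * \<D> f5 * (xw - cst 4 * xp)) * (1 + xw + cst 3 * xp) * g5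
     - (\<D> (1 + xw + cst 3 * xp) * g5 + cst 4 * \<D> g5 * (1 + xw + cst 3 * xp)) * (xw - cst 4 * xp) * f5)
   = U_num * (xw - cst 4 * xp) * (1 + xw + cst 3 * xp)"
  by (simp add: CP_defs CP_eval)

text \<open>This identity makes \<open>U_num\<close> cancel from the pulled-back equation: its cofactor \<open>\<Lambda>\<close> is polynomial.\<close>
lemma U_num_ode: "cst 2 * U_den * \<D> (\<D> U_num) + (cst 2 * \<D> U_den - cst 3 * cden_log) * \<D> U_num = cst 2 * \<Lambda> * U_num"
  by (simp add: CP_defs CP_eval)

text \<open>Obtained by applying D to 1 - \<Phi> = U^2 / \<open>cden\<close>, inserting D\<Phi> =
  \<Phi> U / N and cancelling one factor U.\<close>

lemma U_num_deriv: "cden_log * U_num - cst 2 * U_den * \<D> U_num = cden - U_num\<^sup>2"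
  by (simp add: CP_defs CP_eval)

section \<open>Logarithmic derivatives of the radicals and the pulled-back equation\<close>

definition "f6_log = CP [:-10, -14:] [:-6:]"
definition "f6t_log = CP [:10, 14:] [:-6:]"

text \<open>The zeros of \<open>f6\<close> and \<open>f6t\<close> lie over p = 1 only, so fractional
  powers of them add no singularity beyond those of 1 - p.\<close>

lemma f6_logderiv: "(1 - xp) * \<D> f6 = f6_log * f6" "(1 - xp) * \<D> f6t = f6t_log * f6t"
  by (simp_all add: CP_defs CP_eval f6_log_def f6t_log_def)

text \<open>The exponents \<open>a\<close> to \<open>e\<close> are scaled by 28 to keep the coefficients integral; \<open>h\<close> is the unscaled exponent of $1/t$.\<close>
definition radical_num :: "complex \<Rightarrow> complex \<Rightarrow> complex \<Rightarrow> complex \<Rightarrow> complex \<Rightarrow> complex \<Rightarrow> curve_poly" where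
  "radical_num a b c d e h = xp * f5 * g5 * (cst b * f6_log + cst c * f6t_log - cst (2 * a) * xw)
     + xp * (1 - xp) * (cst d * f5 * \<D> g5 + cst e * g5 * \<D> f5) - cst (28 * h) * (1 - xp) * f5 * g5 * xw"

text \<open>If $28\,N\,DS = m S$, then $28\,N^{k+1} D(N^{-k} z S) = y S$ with $y$ = \<open>ode_step k m z\<close>.\<close>
definition ode_step :: "complex \<Rightarrow> curve_poly \<Rightarrow> curve_poly \<Rightarrow> curve_poly" where
  "ode_step k m z = cst 28 * U_den * \<D> z + (m - cst (28 * k) * \<D> U_den) * z"

text \<open>The parameters are $28(\beta_1+\beta_2-2)$, $28^2(\beta_1-1)(\beta_2-1)$, $28^2 e_2(\alpha)$ and
  $28^3 e_3(\alpha)$; the relation $\sum\alpha = \sum\beta - 1/2$ is already used.\<close>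
definition ode_defect where
  "ode_defect c1 c2 e2 e3 z z1 z2 z3 =
     z3 + (cst c1 * U_num - cst 42 * cden_log + cst 84 * \<D> U_den) * z2
     + (cst c2 * cden - cst e2 * (cden - U_num\<^sup>2) + cst (28 * c1) * (U_num * \<D> U_den - U_den * \<D> U_num)
        + cst 784 * (U_den * \<D> (\<D> U_den) + (\<D> U_den)\<^sup>2 - U_den * \<Lambda>) - cst 1176 * cden_log * \<D> U_den) * z1
     - cst e3 * (cden - U_num\<^sup>2) * U_num * z"

definition solves_ode where
  "solves_ode c1 c2 e2 e3 m z \<longleftrightarrow>
     ode_defect c1 c2 e2 e3 z (ode_step 0 m z) (ode_step 1 m (ode_step 0 m z)) (ode_step 2 m (ode_step 1 m (ode_step 0 m z))) = 0"

text \<open>Here z is (1 - 7w - 21p)(1 - p)^2 / (1 - w + 3p), a polynomial on the curve; the factor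
  (1 - p)^2 turns the exponent 6/7 into -8/7 = -32/28.\<close>

lemma solves_ode_1:
  "solves_ode (-16) 48 111 (-594) (radical_num (-32) 6 0 (-12) 0 0) (CP [:1, -32, 7:] [:-6:])"
  unfolding solves_ode_def
  by (simp add: CP_defs CP_eval ode_step_def ode_defect_def radical_num_def f6_log_def f6t_log_def)

lemma solves_ode_2:
  "solves_ode (-4) (-32) 367 330 (radical_num 8 0 2 4 (-28) 0) (CP [:3, -7:] 0)"
  unfolding solves_ode_def
  by (simp add: CP_defs CP_eval ode_step_def ode_defect_def radical_num_def f6_log_def f6t_log_def)

text \<open>Here z is (1 + 7w - 21p) p (1 - p) / (w - 4p). Compared with the right-hand side it has
  gained a factor t(1 - p), whence the exponent 4/7 - 1 = -12/28 and the last argument 1.\<close>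

lemma solves_ode_3:
  "solves_ode 20 96 1167 6210 (radical_num (-12) 0 4 36 (-84) 1) (CP [:0, 11, -7:] [:1:])"
  unfolding solves_ode_def
  by (simp add: CP_defs CP_eval ode_step_def ode_defect_def radical_num_def f6_log_def f6t_log_def)

subsection \<open>Functions of the local parameter\<close>

definition E4s :: "complex \<Rightarrow> complex" where
  "E4s t = csqrt (1 + 22*t^2 - 7*t^4)"

definition ev :: "complex \<Rightarrow> curve_poly \<Rightarrow> complex" where
  "ev t x = poly (const_part x) (E4p t) + poly (w_part x) (E4p t) * E4w t"

lemma E4s_square: "(E4s t)\<^sup>2 = 1 + 22*t^2 - 7*t^4"
  by (simp add: E4s_def)

lemma E4w_square: "E4w t * E4w t = poly [:0, 1, 22, -7:] (E4p t)"
proof -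
  have "E4w t * E4w t = t\<^sup>2 * (E4s t)\<^sup>2"
    by (simp add: E4w_def E4s_def power2_eq_square mult_ac)
  then show ?thesis
    unfolding E4s_square E4p_def by (simp add: algebra_simps flip: power_add)
qed

lemma ev_arith [simp]:
  "ev t (x + y) = ev t x + ev t y" "ev t (x - y) = ev t x - ev t y" "ev t (- x) = - ev t x"
  "ev t (cst c) = c" "ev t 0 = 0" "ev t 1 = 1"
  by (simp_all add: ev_def plus_curve_poly_def minus_curve_poly_def uminus_curve_poly_def cst_def
      zero_curve_poly_def one_curve_poly_def algebra_simps)

text \<open>Evaluation is multiplicative because the parametrised point lies on the curve, so the
  reduction built into the product is respected.\<close>

lemma ev_mult [simp]: "ev t (x * y) = ev t x * ev t y"
proof -
  define u where "u = poly [:0, 1, 22, -7:] (E4p t)"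
  have w: "E4w t * E4w t = u"
    by (simp only: u_def E4w_square)
  show ?thesis
    unfolding ev_def times_curve_poly_def curve_poly.sel poly_add poly_mult u_def [symmetric] w [symmetric]
    by (simp add: algebra_simps)
qed

lemma ev_power [simp]: "ev t (x ^ n) = ev t x ^ n"
  by (induction n) auto

lemma ev_coord [simp]: "ev t xp = E4p t" "ev t xw = E4w t"
  by (simp_all add: ev_def xp_def xw_def)

lemma ev_forms:
  "ev t f5 = F5 (E4p t) (E4w t)" "ev t f6 = F6 (E4p t) (E4w t)"
  "ev t f6t = F6t (E4p t) (E4w t)" "ev t g5 = G5 (E4p t) (E4w t)"
  by (simp_all add: ev_def f5_def f6_def f6t_def g5_def F5_def F6_def F6t_def G5_def algebra_simps
      power2_eq_square power3_eq_cube)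

lemma E4s_nonzero: "1 + 22*t^2 - 7*t^4 \<notin> \<real>\<^sub>\<le>\<^sub>0 \<Longrightarrow> E4s t \<noteq> 0"
  by (auto simp: E4s_def)

lemma E4w_eq: "E4w t = t * E4s t"
  by (simp add: E4w_def E4s_def)

lemma E4w_deriv:
  assumes "1 + 22*t^2 - 7*t^4 \<notin> \<real>\<^sub>\<le>\<^sub>0"
  shows "(E4w has_field_derivative poly [:1, 44, -21:] (E4p t) / E4s t) (at t)"
proof -
  have s: "E4s t \<noteq> 0" using E4s_nonzero assms .
  have "(E4w has_field_derivative E4s t + t * ((44 * t - 28 * t^3) / (2 * E4s t))) (at t)"
    unfolding E4w_def [abs_def] E4s_def using assms
    by (auto intro!: derivative_eq_intros has_field_derivative_csqrt' simp: field_simps)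
  \<comment> \<open>Over the common denominator, \<open>E4s_square\<close> turns the numerator into
    1 + 44 t^2 - 21 t^4, the derivative of the cubic at p = t^2.\<close>
  moreover have "E4s t + t * ((44 * t - 28 * t^3) / (2 * E4s t)) = ((E4s t)\<^sup>2 + 22 * t^2 - 14 * t^4) / E4s t"
    using s by (simp add: field_simps power2_eq_square power3_eq_cube power4_eq_xxxx)
  moreover have "(E4s t)\<^sup>2 + 22 * t^2 - 14 * t^4 = poly [:1, 44, -21:] (E4p t)"
    by (simp add: E4s_square E4p_def algebra_simps flip: power_add)
  ultimately show ?thesis by simp
qed

text \<open>The bridge from algebra to analysis: dp/dt = 2t = 2w/s and dw/dt = c'(p)/s, so
  \<open>\<D>\<close> is s d/dt in the parameter t.\<close>

lemma ev_deriv: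
  assumes "1 + 22*t^2 - 7*t^4 \<notin> \<real>\<^sub>\<le>\<^sub>0"
  shows "((\<lambda>t. ev t x) has_field_derivative ev t (\<D> x) / E4s t) (at t)"
proof -
  have s: "E4s t \<noteq> 0" using E4s_nonzero assms .
  have p: "(E4p has_field_derivative 2 * E4w t / E4s t) (at t)"
    unfolding E4p_def [abs_def] using s by (auto intro!: derivative_eq_intros simp: E4w_eq)
  have P: "((\<lambda>t. poly a (E4p t)) has_field_derivative poly (pderiv a) (E4p t) * (2 * E4w t / E4s t)) (at t)" for a
    by (rule DERIV_chain2[OF poly_DERIV p])
  define u where "u = poly [:0, 1, 22, -7:] (E4p t)"
  have w: "E4w t * E4w t = u"
    by (simp only: u_def E4w_square)
  show ?thesis
    unfolding ev_def
  proof (rule DERIV_cong[OF DERIV_add[OF P DERIV_mult[OF P E4w_deriv[OF assms]]]], goal_cases)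
    case 1
    show ?case
      unfolding \<D>_def curve_poly.sel poly_add poly_mult poly_smult u_def [symmetric] w [symmetric]
      using s by (simp add: field_simps del: poly_pCons)
  qed
qed

section \<open>The covering map in the local parameter\<close>

definition \<Phi> :: "complex \<Rightarrow> complex" where
  "\<Phi> t = Phi4 (E4p t) (E4w t)"

lemma Phi_eq:
  "\<Phi> t = 512 * ev t (xw - cst 4 * xp) * ev t f5 ^ 7 / (ev t (1 + xw + cst 3 * xp) * ev t g5 ^ 4)"
  by (simp add: \<Phi>_def Phi4_def ev_forms)

text \<open>Each function in the set has value 1 at t = 0. Avoiding the branch cut makes it nonzero
  and its principal powers differentiable. The last condition concerns (w - 4p)/t.\<close>

definition regular :: "complex \<Rightarrow> bool" where
  "regular t \<longleftrightarrow> 1 + 22*t^2 - 7*t^4 \<notin> \<real>\<^sub>\<le>\<^sub>0 \<and>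
     (\<forall>x \<in> {1 - xp, f5, f6, f6t, g5, 1 + xw + cst 3 * xp, 1 - xw + cst 3 * xp, 1 + cst 7 * xp}. ev t x \<notin> \<real>\<^sub>\<le>\<^sub>0)
     \<and> E4s t - 4 * t \<noteq> 0"

lemma eventually_notin_nonpos:
  fixes h :: "complex \<Rightarrow> complex"
  assumes "isCont h 0" "h 0 = 1"
  shows "\<forall>\<^sub>F t in nhds 0. h t \<notin> \<real>\<^sub>\<le>\<^sub>0"
proof -
  have "open (- (\<real>\<^sub>\<le>\<^sub>0 :: complex set))"
    using closed_nonpos_Reals_complex by (simp add: open_Compl)
  moreover have "(h \<longlongrightarrow> 1) (nhds 0)"
    using assms by (simp add: tendsto_nhds_iff isCont_def)
  ultimately have "\<forall>\<^sub>F t in nhds 0. h t \<in> - \<real>\<^sub>\<le>\<^sub>0"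
    by (intro topological_tendstoD) auto
  then show ?thesis by simp
qed

lemma ev_at_0: "ev 0 x = poly (const_part x) 0"
  by (simp add: ev_def E4p_def E4w_def)

lemma isCont_ev_0: "isCont (\<lambda>t. ev t x) 0"
  by (rule DERIV_isCont[OF ev_deriv]) simp

lemma E4s_analytic: "1 + 22*t^2 - 7*t^4 \<notin> \<real>\<^sub>\<le>\<^sub>0 \<Longrightarrow> E4s analytic_on {t}"
  unfolding E4s_def [abs_def] by (intro analytic_intros) auto

lemma eventually_regular: "\<forall>\<^sub>F t in nhds 0. regular t"
proof -
  have *: "\<forall>\<^sub>F t in nhds 0. ev t x \<notin> \<real>\<^sub>\<le>\<^sub>0" if "ev 0 x = 1" for x
    by (rule eventually_notin_nonpos) (use that in \<open>auto simp: isCont_ev_0\<close>)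
  have "\<forall>\<^sub>F t in nhds 0. \<forall>x \<in> {1 - xp, f5, f6, f6t, g5, 1 + xw + cst 3 * xp, 1 - xw + cst 3 * xp, 1 + cst 7 * xp}.
      ev t x \<notin> \<real>\<^sub>\<le>\<^sub>0"
    by (intro eventually_ball_finite ballI *)
       (auto simp: ev_forms F5_def F6_def F6t_def G5_def E4p_def E4w_def)
  moreover have "\<forall>\<^sub>F t::complex in nhds 0. 1 + 22*t^2 - 7*t^4 \<notin> \<real>\<^sub>\<le>\<^sub>0"
    by (rule eventually_notin_nonpos) (auto intro!: continuous_intros)
  moreover have "\<forall>\<^sub>F t in nhds 0. E4s t - 4 * t \<notin> \<real>\<^sub>\<le>\<^sub>0"
  proof (rule eventually_notin_nonpos)
    show "isCont (\<lambda>t. E4s t - 4 * t) 0"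
      by (intro continuous_intros analytic_at_imp_isCont E4s_analytic) auto
  qed (simp add: E4s_def)
  ultimately show ?thesis
    by eventually_elim (auto simp: regular_def)
qed

lemma regular_0: "regular 0"
  using eventually_regular by (rule eventually_nhds_x_imp_x)

lemma regular_nonzero:
  assumes "regular t"
  shows "1 - E4p t \<noteq> 0" "ev t f5 \<noteq> 0" "ev t f6 \<noteq> 0" "ev t f6t \<noteq> 0" "ev t g5 \<noteq> 0"
    "1 + E4w t + 3 * E4p t \<noteq> 0" "1 - E4w t + 3 * E4p t \<noteq> 0" "1 + 7 * E4p t \<noteq> 0" "E4s t \<noteq> 0"
    "E4s t - 4 * t \<noteq> 0"
  using assms E4s_nonzero[of t] unfolding regular_def by auto

lemma ev_deriv_regular:
  "regular t \<Longrightarrow> ((\<lambda>t. ev t x) has_field_derivative ev t (\<D> x) / E4s t) (at t)"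
  by (rule ev_deriv) (simp add: regular_def)

text \<open>The derivative is left without division by \<Phi> or p, so that it also holds at t = 0,
  where the quotient \<open>U_num\<close> / \<open>U_den\<close> has a pole.\<close>

lemma Phi_deriv:
  assumes "regular t"
  shows "(\<Phi> has_field_derivative
     512 * ev t f5 ^ 6 / (ev t (1 + xw + cst 3 * xp) ^ 2 * ev t g5 ^ 5 * E4s t) *
       ev t ((\<D> (xw - cst 4 * xp) * f5 + cst 7 * \<D> f5 * (xw - cst 4 * xp)) * (1 + xw + cst 3 * xp) * g5
     - (\<D> (1 + xw + cst 3 * xp) * g5 + cst 4 * \<D> g5 * (1 + xw + cst 3 * xp)) * (xw - cst 4 * xp) * f5)) (at t)"
proof -
  define u v where "u = xw - cst 4 * xp" and "v = 1 + xw + cst 3 * xp"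
  have nz: "ev t v \<noteq> 0" "ev t g5 \<noteq> 0" "E4s t \<noteq> 0"
    using regular_nonzero[OF assms] by (auto simp: v_def)
  show ?thesis
    unfolding Phi_eq [abs_def] u_def [symmetric] v_def [symmetric]
    by (rule derivative_eq_intros ev_deriv_regular assms refl)+
       (use nz in \<open>simp_all add: divide_simps\<close>, simp add: algebra_simps eval_nat_numeral)
qed

lemma Phi_differentiable: "regular t \<Longrightarrow> \<Phi> field_differentiable at t"
  using Phi_deriv field_differentiable_def by blast

lemma Phi_logderiv:
  assumes "regular t" "t \<noteq> 0"
  shows "(\<Phi> has_field_derivative \<Phi> t * ev t U_num / (ev t U_den * E4s t)) (at t)"
proof (rule DERIV_cong[OF Phi_deriv[OF assms(1)]])
  define u v where "u = xw - cst 4 * xp" and "v = 1 + xw + cst 3 * xp"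
  have nz: "ev t v \<noteq> 0" "ev t g5 \<noteq> 0" "E4s t \<noteq> 0" "ev t f5 \<noteq> 0" "1 - E4p t \<noteq> 0" "E4p t \<noteq> 0"
    using regular_nonzero[OF assms(1)] assms(2) by (auto simp: v_def E4p_def)
  define K where "K = (\<D> u * f5 + cst 7 * \<D> f5 * u) * v * g5 - (\<D> v * g5 + cst 4 * \<D> g5 * v) * u * f5"
  have "E4p t * (1 - E4p t) * ev t K = ev t U_num * ev t u * ev t v"
    using arg_cong[OF U_num_logderiv, of "ev t"] unfolding u_def [symmetric] v_def [symmetric] K_def [symmetric] by simp
  then have K: "ev t K = ev t U_num * ev t u * ev t v / (E4p t * (1 - E4p t))"
    using nz by (simp add: field_simps)
  show "512 * ev t f5 ^ 6 / (ev t (1 + xw + cst 3 * xp) ^ 2 * ev t g5 ^ 5 * E4s t) *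
       ev t ((\<D> (xw - cst 4 * xp) * f5 + cst 7 * \<D> f5 * (xw - cst 4 * xp)) * (1 + xw + cst 3 * xp) * g5
     - (\<D> (1 + xw + cst 3 * xp) * g5 + cst 4 * \<D> g5 * (1 + xw + cst 3 * xp)) * (xw - cst 4 * xp) * f5)
     = \<Phi> t * ev t U_num / (ev t U_den * E4s t)"
    unfolding Phi_eq u_def [symmetric] v_def [symmetric] K_def [symmetric] K U_den_eq ev_mult ev_arith ev_coord
    using nz by (simp add: divide_simps) (simp add: algebra_simps eval_nat_numeral)
qed

lemma Phi_U_num:
  assumes "regular t"
  shows "ev t cden * \<Phi> t = ev t cden - (ev t U_num)\<^sup>2"
proof -
  define u v where "u = xw - cst 4 * xp" and "v = 1 + xw + cst 3 * xp"
  have nz: "ev t v \<noteq> 0" "ev t g5 \<noteq> 0"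
    using regular_nonzero[OF assms(1)] by (auto simp: v_def)
  have "ev t v * (ev t cden - (ev t U_num)\<^sup>2) = 512 * E4p t * ev t u * ev t f5 ^ 7"
    using arg_cong[OF U_num_square, of "ev t"] unfolding u_def [symmetric] v_def [symmetric] by simp
  then have "ev t cden - (ev t U_num)\<^sup>2 = 512 * E4p t * ev t u * ev t f5 ^ 7 / ev t v"
    using nz by (simp add: field_simps)
  also have "\<dots> = ev t cden * \<Phi> t"
    unfolding Phi_eq u_def [symmetric] v_def [symmetric] cden_def using nz by simp
  finally show ?thesis by simp
qed

lemma Phi_0: "\<Phi> 0 = 0"
  by (simp add: Phi_eq E4p_def E4w_def)

text \<open>Near t = 0 the factor w - 4p is t to first order and the other factors tend to 1; the
  nonzero derivative makes \<Phi> a local coordinate.\<close>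

lemma Phi_deriv_0: "(\<Phi> has_field_derivative 512) (at 0)"
  using Phi_deriv[OF regular_0]
  by (simp add: CP_defs CP_arith \<D>_def ev_at_0 E4s_def pderiv_pCons)

section \<open>The radical factors and their logarithmic derivatives\<close>

definition radical :: "complex \<Rightarrow> complex \<Rightarrow> complex \<Rightarrow> complex \<Rightarrow> complex \<Rightarrow> nat \<Rightarrow> complex \<Rightarrow> complex" where
  "radical a b c d e k t = ev t (1 - xp) powr (a/28) * ev t f6 powr (b/28) * ev t f6t powr (c/28)
     * ev t g5 powr (d/28) * ev t f5 powr (e/28) / t ^ k"

lemma radical_deriv:
  fixes a b c d e :: complex and k :: nat
  assumes "regular t" "t \<noteq> 0"
  defines "S \<equiv> radical a b c d e k"
  shows "(S has_field_derivative S t * ev t (radical_num a b c d e (of_nat k)) / (28 * ev t U_den * E4s t)) (at t)"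
proof -
  \<comment> \<open>The product rule is put in logarithmic form, so that it can be iterated over the
    factors.\<close>
  have mult: "((\<lambda>t. f t * g t) has_field_derivative f t * g t * (x + y)) (at t)"
    if "(f has_field_derivative f t * x) (at t)" "(g has_field_derivative g t * y) (at t)" for f g :: "complex \<Rightarrow> complex" and x y
    using DERIV_mult[OF that] by (simp add: algebra_simps)
  have pw: "((\<lambda>t. ev t x powr r) has_field_derivative ev t x powr r * (r * (ev t (\<D> x) / ev t x) / E4s t)) (at t)"
    if "ev t x \<notin> \<real>\<^sub>\<le>\<^sub>0" for x r
  proof -
    have "ev t x \<noteq> 0" using that by auto
    then show ?thesis
      by (intro DERIV_cong[OF DERIV_chain2[OF has_field_derivative_powr[OF that] ev_deriv_regular[OF assms(1)]]])
         (simp add: powr_diff field_simps)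
  qed
  have tk: "((\<lambda>t. inverse (t ^ k)) has_field_derivative inverse (t ^ k) * (- of_nat k / t)) (at t)"
  proof (rule DERIV_cong[OF DERIV_inverse'[OF DERIV_power[OF DERIV_ident]]])
    show "- (inverse (t ^ k) * (of_nat k * (1 * t ^ (k - Suc 0))) * inverse (t ^ k)) = inverse (t ^ k) * (- of_nat k / t)"
      using assms(2) by (cases k) (auto simp: field_simps)
  qed (use assms(2) in auto)
  have reg: "ev t x \<notin> \<real>\<^sub>\<le>\<^sub>0" if "x \<in> {1 - xp, f5, f6, f6t, g5}" for x
    using assms(1) that unfolding regular_def by blast
  have nz: "ev t g5 \<noteq> 0" "E4s t \<noteq> 0" "ev t f5 \<noteq> 0" "1 - E4p t \<noteq> 0" "ev t f6 \<noteq> 0" "ev t f6t \<noteq> 0"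
    using regular_nonzero[OF assms(1)] by auto
  define logd where "logd = (\<lambda>x. ev t (\<D> x) / ev t x)"
  define L where "L = (a/28) * logd (1 - xp) / E4s t + (b/28) * logd f6 / E4s t + (c/28) * logd f6t / E4s t
        + (d/28) * logd g5 / E4s t + (e/28) * logd f5 / E4s t + - of_nat k / t"
  have "(S has_field_derivative S t * L) (at t)"
    unfolding S_def radical_def [abs_def] L_def divide_inverse[of _ "_ ^ k"] logd_def by (intro mult pw tk reg) auto
  moreover have "L = ev t (radical_num a b c d e (of_nat k)) / (28 * ev t U_den * E4s t)"
  proof -
    define P where "P = 1 - E4p t"
    have P: "P \<noteq> 0" "E4p t \<noteq> 0"
      using nz assms(2) by (auto simp: P_def E4p_def)
    have "P * ev t (\<D> f6) = ev t f6_log * ev t f6" "P * ev t (\<D> f6t) = ev t f6t_log * ev t f6t"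
      using arg_cong[OF f6_logderiv(1), of "ev t"] arg_cong[OF f6_logderiv(2), of "ev t"] by (simp_all add: P_def)
    then have 1: "logd f6 = ev t f6_log / P" "logd f6t = ev t f6t_log / P"
      using nz P by (simp_all add: logd_def field_simps)
    have 2: "logd (1 - xp) = - (2 * E4w t / P)"
      by (simp add: logd_def P_def) (simp add: CP_defs CP_arith \<D>_def ev_def pderiv_pCons)
    \<comment> \<open>The parameter t is not in the coordinate ring, but its logarithmic derivative
      under D is s/t = w/p.\<close>
    have 3: "1 / t = E4w t / (E4p t * E4s t)"
      using nz assms(2) by (simp add: E4w_eq E4p_def power2_eq_square)
    have "L = ((a/28) * logd (1 - xp) + (b/28) * logd f6 + (c/28) * logd f6t + (d/28) * logd g5
        + (e/28) * logd f5) / E4s t - of_nat k * (1 / t)"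
      unfolding L_def by (simp add: add_divide_distrib)
    also have "\<dots> = ev t (radical_num a b c d e (of_nat k)) / (28 * ev t U_den * E4s t)"
      unfolding 1 2 3 unfolding logd_def radical_num_def U_den_eq ev_arith ev_mult ev_coord P_def [symmetric]
      using nz P by (simp add: divide_simps) (simp add: algebra_simps)
    finally show ?thesis .
  qed
  ultimately show ?thesis by simp
qed

subsection \<open>Pulling back the hypergeometric equation\<close>

text \<open>The equation is \<theta>(\<theta>+b1-1)(\<theta>+b2-1) f =
  z(\<theta>+a1)(\<theta>+a2)(\<theta>+a3) f. By the conditions on b1 and b2 the indicial polynomial
  has no positive integer root, so the constant term determines the power series.\<close>

lemma hyp3F2_unique:
  fixes f :: "complex \<Rightarrow> complex" and a1 a2 a3 b1 b2 :: complex
  defines "\<theta> \<equiv> \<lambda>f z. z * deriv f z"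
  assumes f: "f analytic_on {0}" "f 0 = 1"
    and ode: "\<forall>\<^sub>F z in nhds 0.
      (1 - z) * \<theta> (\<theta> (\<theta> f)) z + (b1 + b2 - 2 - (a1 + a2 + a3) * z) * \<theta> (\<theta> f) z
      + ((b1 - 1) * (b2 - 1) - (a1 * a2 + a1 * a3 + a2 * a3) * z) * \<theta> f z - a1 * a2 * a3 * z * f z = 0"
    and b: "\<And>k. b1 + of_nat k \<noteq> 0" "\<And>k. b2 + of_nat k \<noteq> 0"
  shows "\<forall>\<^sub>F z in nhds 0. f z = hyp3F2 a1 a2 a3 b1 b2 z"
proof -
  define F where "F = fps_expansion f 0"
  have F: "f has_fps_expansion F"
    unfolding F_def using f(1) by (rule analytic_at_imp_has_fps_expansion_0)
  define T where "T = (\<lambda>G :: complex fps. fps_X * fps_deriv G)"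
  have T: "\<theta> h has_fps_expansion T H" if "h has_fps_expansion H" for h H
    unfolding \<theta>_def T_def by (intro fps_expansion_intros that)
  let ?P = "(1 - fps_X) * T (T (T F)) + (fps_const (b1 + b2 - 2) - fps_const (a1 + a2 + a3) * fps_X) * T (T F)
      + (fps_const ((b1 - 1) * (b2 - 1)) - fps_const (a1 * a2 + a1 * a3 + a2 * a3) * fps_X) * T F
      - fps_const (a1 * a2 * a3) * fps_X * F"
  let ?h = "\<lambda>z. (1 - z) * \<theta> (\<theta> (\<theta> f)) z + (b1 + b2 - 2 - (a1 + a2 + a3) * z) * \<theta> (\<theta> f) z
      + ((b1 - 1) * (b2 - 1) - (a1 * a2 + a1 * a3 + a2 * a3) * z) * \<theta> f z - a1 * a2 * a3 * z * f z"
  have "?h has_fps_expansion ?P"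
    by (intro fps_expansion_intros T F)
  moreover have "?h has_fps_expansion 0"
    using ode by (simp add: has_fps_expansion_0_iff)
  ultimately have P: "?P = 0"
    by (rule fps_expansion_unique_complex)
  \<comment> \<open>The Euler operator acts diagonally on coefficients, so comparing the
    coefficients of z^(n+1) gives a two-term recurrence.\<close>
  have Tn: "fps_nth (T G) n = of_nat n * fps_nth G n" for G n
    unfolding T_def by (cases n) auto
  have rec: "fps_nth F (Suc n) * ((of_nat n + 1) * (b1 + of_nat n) * (b2 + of_nat n))
       = (a1 + of_nat n) * (a2 + of_nat n) * (a3 + of_nat n) * fps_nth F n" for n
  proof -
    have "fps_nth ?P (Suc n) = 0"
      by (simp only: P fps_zero_nth)
    then show ?thesis
      by (simp add: Tn left_diff_distrib mult.assoc) (simp add: algebra_simps)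
  qed
  have coeff: "fps_nth F n = pochhammer a1 n * pochhammer a2 n * pochhammer a3 n
      / (pochhammer b1 n * pochhammer b2 n * fact n)" for n
  proof (induction n)
    case 0
    then show ?case using f(2) F has_fps_expansion_imp_0_eq_fps_nth_0 by fastforce
  next
    case (Suc n)
    have nz: "pochhammer b1 k \<noteq> 0" "pochhammer b2 k \<noteq> 0" for k
      using b by (auto simp: pochhammer_eq_0_iff eq_neg_iff_add_eq_0)
    have "(of_nat n + 1 :: complex) \<noteq> 0"
      by (metis of_nat_Suc of_nat_neq_0 add.commute)
    with rec[of n] b have "fps_nth F (Suc n) = (a1 + of_nat n) * (a2 + of_nat n) * (a3 + of_nat n) * fps_nth F n
        / ((of_nat n + 1) * (b1 + of_nat n) * (b2 + of_nat n))"
      by (simp add: eq_divide_eq)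
    then show ?case
      by (simp add: Suc.IH pochhammer_Suc mult_ac add_ac)
  qed
  have "\<forall>\<^sub>F z in nhds 0. eval_fps F z = f z"
    using F by (simp add: has_fps_expansion_def)
  then show ?thesis
    by eventually_elim (simp add: eval_fps_def hyp3F2_def coeff)
qed

text \<open>Transporting R along the local inverse of \<Phi> gives a holomorphic germ f with f(0) =
  1. The algebraic identity \<open>sol\<close> makes f solve the hypergeometric equation, and
  uniqueness identifies it. The factor S may have a pole at 0, hence the punctured
  neighbourhoods.\<close>

lemma hypergeometric_pullback:
  fixes a1 a2 a3 b1 b2 :: complex
  assumes R: "R analytic_on {0}" "R 0 = 1"
    and RS: "\<forall>\<^sub>F t in at 0. R t = ev t z * S t"
    and S: "\<forall>\<^sub>F t in at 0. (S has_field_derivative S t * ev t m / (28 * ev t U_den * E4s t)) (at t)"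
    and sol: "solves_ode (28 * (b1 + b2 - 2)) (784 * ((b1 - 1) * (b2 - 1)))
                (784 * (a1 * a2 + a1 * a3 + a2 * a3)) (21952 * (a1 * a2 * a3)) m z"
    and ab: "a1 + a2 + a3 = b1 + b2 - 1 / 2"
    and b: "\<And>k. b1 + of_nat k \<noteq> 0" "\<And>k. b2 + of_nat k \<noteq> 0"
  shows "\<forall>\<^sub>F t in at 0. hyp3F2 a1 a2 a3 b1 b2 (\<Phi> t) = R t"
proof -
  obtain r0 where r0: "r0 > 0" "R holomorphic_on ball 0 r0"
    using R(1) by (auto simp: analytic_at_ball)
  obtain r1 where r1: "r1 > 0" "\<And>t. t \<in> ball 0 r1 \<Longrightarrow> regular t"
    using eventually_regular by (auto simp: eventually_nhds_metric dist_commute)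
  have hol: "\<Phi> holomorphic_on ball 0 (min r0 r1)"
    unfolding holomorphic_on_def
    by (rule ballI, rule field_differentiable_at_within, rule Phi_differentiable, rule r1(2)) auto
  have dnz: "deriv \<Phi> 0 \<noteq> 0"
    using DERIV_imp_deriv[OF Phi_deriv_0] by simp
  have z: "(0::complex) \<in> ball 0 (min r0 r1)"
    using r0(1) r1(1) by simp
  obtain r where r: "r > 0" "ball (0::complex) r \<subseteq> ball 0 (min r0 r1)" "open (\<Phi> ` ball 0 r)" "inj_on \<Phi> (ball 0 r)"
    using has_complex_derivative_locally_invertible[OF hol z open_ball dnz] by blast
  define B where "B = ball (0::complex) r"
  define V where "V = \<Phi> ` B"
  have B: "open B" "0 \<in> B" "\<And>t. t \<in> B \<Longrightarrow> regular t"
    using r r1 by (auto simp: B_def)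
  have V: "open V" "0 \<in> V"
    using r Phi_0 B(2) by (auto simp: V_def B_def image_iff intro!: bexI[of _ 0])
  obtain g where g: "g holomorphic_on V" "\<And>t. t \<in> B \<Longrightarrow> g (\<Phi> t) = t"
    unfolding V_def B_def
    using holomorphic_has_inverse[OF holomorphic_on_subset[OF hol r(2)] open_ball r(4)] by metis
  define \<theta> :: "(complex \<Rightarrow> complex) \<Rightarrow> complex \<Rightarrow> complex" where "\<theta> = (\<lambda>f z. z * deriv f z)"
  define f where "f = R \<circ> g"
  have f: "f holomorphic_on V"
    unfolding f_def
  proof (rule holomorphic_on_compose_gen[OF g(1)])
    show "R holomorphic_on B"
      by (rule holomorphic_on_subset[OF r0(2)]) (use r(2) in \<open>force simp: B_def\<close>)
    show "g ` V \<subseteq> B"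
      using g(2) by (auto simp: V_def)
  qed
  have \<theta>: "\<theta> h holomorphic_on V" if "h holomorphic_on V" for h
    unfolding \<theta>_def using that V by (intro holomorphic_intros) auto
  have fPhi: "f (\<Phi> t) = R t" if "t \<in> B" for t
    using g(2)[OF that] by (simp add: f_def)
  \<comment> \<open>The chain rule in invariant form: D(h o \<Phi>) = (\<theta> h o \<Phi>) U /
    N.\<close>
  have dPhi: "((\<lambda>t. h (\<Phi> t)) has_field_derivative \<theta> h (\<Phi> t) * ev t U_num / (ev t U_den * E4s t)) (at t)"
    if "h holomorphic_on V" "t \<in> B" "t \<noteq> 0" for h t
  proof -
    have "(h has_field_derivative deriv h (\<Phi> t)) (at (\<Phi> t))"
      using that V by (intro holomorphic_derivI) (auto simp: V_def)
    from DERIV_chain2[OF this Phi_logderiv[OF B(3) that(3)]] that show ?thesis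
      by (simp add: \<theta>_def mult_ac)
  qed

  have cont: "(\<Phi> \<longlongrightarrow> 0) (nhds 0)"
    using DERIV_isCont[OF Phi_deriv_0] by (simp add: isCont_def Phi_0 tendsto_nhds_iff)
  have "\<forall>\<^sub>F t in at 0. \<Phi> t \<noteq> 1 \<and> t \<in> B \<and> t \<noteq> 0 \<and> R t = ev t z * S t
      \<and> (S has_field_derivative S t * ev t m / (28 * ev t U_den * E4s t)) (at t)"
  proof -
    have "\<forall>\<^sub>F t in at 0. \<Phi> t \<noteq> 1"
      using tendsto_imp_eventually_ne[OF filterlim_mono[OF cont order_refl], of "at 0" 1]
      by (simp add: at_within_le_nhds)
    moreover have "\<forall>\<^sub>F t in at 0. t \<in> B"
      using B by (intro eventually_at_in_open') auto
    ultimately show ?thesis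
      using RS S eventually_neq_at_within[of 0 0 UNIV] by eventually_elim auto
  qed
  then obtain \<rho> where \<rho>: "\<rho> > 0" and W': "\<And>t. t \<in> ball 0 \<rho> - {0} \<Longrightarrow> \<Phi> t \<noteq> 1 \<and> t \<in> B \<and> t \<noteq> 0 \<and> R t = ev t z * S t
      \<and> (S has_field_derivative S t * ev t m / (28 * ev t U_den * E4s t)) (at t)"
    unfolding eventually_at by (auto simp: dist_commute)
  \<comment> \<open>On this set neither \<open>U_den\<close> (zero at t = 0) nor
    \<open>U_num\<close> (zero where \<Phi> = 1) vanishes, so both can be cancelled.\<close>
  define W where "W = ball (0::complex) \<rho> - {0}"
  have W: "open W" "\<And>t. t \<in> W \<Longrightarrow> \<Phi> t \<noteq> 1" "\<And>t. t \<in> W \<Longrightarrow> t \<in> B" "\<And>t. t \<in> W \<Longrightarrow> t \<noteq> 0"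
    "\<And>t. t \<in> W \<Longrightarrow> R t = ev t z * S t"
    "\<And>t. t \<in> W \<Longrightarrow> (S has_field_derivative S t * ev t m / (28 * ev t U_den * E4s t)) (at t)"
    using W' unfolding W_def by (auto simp: open_delete)
  have deriv_eq: "x = y" if "t \<in> W" "\<And>t. t \<in> W \<Longrightarrow> h t = k t" "(h has_field_derivative x) (at t)"
      "(k has_field_derivative y) (at t)" for h k :: "complex \<Rightarrow> complex" and x y t
    using DERIV_unique[OF has_field_derivative_transform_within_open[OF that(3) W(1) that(1,2)] that(4)] by simp
  define y0 y1 y2 y3 where "y0 = (\<lambda>t. f (\<Phi> t))" and "y1 = (\<lambda>t. \<theta> f (\<Phi> t))"
    and "y2 = (\<lambda>t. \<theta> (\<theta> f) (\<Phi> t))" and "y3 = (\<lambda>t. \<theta> (\<theta> (\<theta> f)) (\<Phi> t))"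
  define z1 z2 z3 where "z1 = ode_step 0 m z" and "z2 = ode_step 1 m z1" and "z3 = ode_step 2 m z2"
  have nz: "ev t U_den \<noteq> 0" "E4s t \<noteq> 0" "ev t U_num \<noteq> 0" "ev t cden \<noteq> 0" if "t \<in> W" for t
  proof -
    have reg: "regular t" and t: "t \<noteq> 0" "\<Phi> t \<noteq> 1"
      using W(2-4)[OF that] B(3) by auto
    show "ev t U_den \<noteq> 0" "E4s t \<noteq> 0" and cden: "ev t cden \<noteq> 0"
      using regular_nonzero[OF reg] t by (auto simp: U_den_eq cden_def E4p_def)
    show "ev t U_num \<noteq> 0"
      using Phi_U_num[OF reg] cden t(2) by auto
  qed
  have dy: "(y0 has_field_derivative y1 t * ev t U_num / (ev t U_den * E4s t)) (at t)"
    "(y1 has_field_derivative y2 t * ev t U_num / (ev t U_den * E4s t)) (at t)"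
    "(y2 has_field_derivative y3 t * ev t U_num / (ev t U_den * E4s t)) (at t)" if "t \<in> W" for t
    unfolding y0_def y1_def y2_def y3_def using W(3,4)[OF that] f \<theta> by (auto intro!: dPhi)
  have dev: "((\<lambda>t. ev t x) has_field_derivative ev t (\<D> x) / E4s t) (at t)" if "t \<in> W" for x t
    using ev_deriv_regular B(3) W(3) that by blast
  have dS: "((\<lambda>t. ev t x * S t) has_field_derivative ev t (cst 28 * U_den * \<D> x + m * x) * S t / (28 * ev t U_den * E4s t)) (at t)"
    if "t \<in> W" for x t
    by (rule DERIV_cong[OF DERIV_mult[OF dev W(6)]]) (use that nz[OF that] in \<open>auto simp: field_simps\<close>)
  have E0: "y0 t = ev t z * S t" if "t \<in> W" for t
    using W(3,5)[OF that] by (simp add: y0_def fPhi)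
  \<comment> \<open>For k = 1, 2, 3, \<open>E1\<close> to \<open>E3\<close> compute 28^k N^k D^k y0
    twice: by the chain rule through \<Phi>, and from y0 = z S.\<close>
  have E1: "28 * ev t U_num * y1 t = ev t z1 * S t" if "t \<in> W" for t
  proof -
    have "y1 t * ev t U_num / (ev t U_den * E4s t) = ev t (cst 28 * U_den * \<D> z + m * z) * S t / (28 * ev t U_den * E4s t)"
      by (rule deriv_eq[OF that E0 dy(1)[OF that] dS[OF that]])
    then show ?thesis
      using nz[OF that] by (simp add: field_simps z1_def ode_step_def)
  qed
  have clear: "28 * c * x = y" if "c * x / (n * s) = y / (28 * n * s)" "n \<noteq> 0" "s \<noteq> 0" for c x y n s :: complex
    using that by (simp add: field_simps)
  have E2: "784 * (ev t (U_den * \<D> U_num - \<D> U_den * U_num) * y1 t + ev t (U_num\<^sup>2) * y2 t) = ev t z2 * S t" if "t \<in> W" for t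
  proof -
    have "((\<lambda>t. 28 * ev t U_num * y1 t) has_field_derivative
        28 * (ev t U_den * ev t (\<D> U_num) * y1 t + ev t U_num ^ 2 * y2 t) / (ev t U_den * E4s t)) (at t)"
      unfolding mult.assoc[of 28]
      by (rule DERIV_cong[OF DERIV_cmult[OF DERIV_mult[OF dev[OF that] dy(2)[OF that]]]])
         (use nz[OF that] in \<open>simp add: field_simps power2_eq_square\<close>)
    from clear[OF deriv_eq[OF that E1 this dS[OF that]] nz(1,2)[OF that]]
    have *: "784 * (ev t U_den * ev t (\<D> U_num) * y1 t + ev t U_num ^ 2 * y2 t) = ev t (cst 28 * U_den * \<D> z1 + m * z1) * S t"
      by simp
    have "ev t z2 * S t = ev t (cst 28 * U_den * \<D> z1 + m * z1) * S t - 28 * ev t (\<D> U_den) * (ev t z1 * S t)"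
      by (simp add: z2_def ode_step_def algebra_simps)
    then show ?thesis
      unfolding * [symmetric] E1[OF that, symmetric] by (simp add: algebra_simps)
  qed
  have E3: "21952 * ((ev t U_den * (ev t U_den * ev t (\<D> (\<D> U_num)) - ev t (\<D> (\<D> U_den)) * ev t U_num)
           - 2 * ev t (\<D> U_den) * (ev t U_den * ev t (\<D> U_num) - ev t (\<D> U_den) * ev t U_num)) * y1 t
        + 3 * ev t U_num * (ev t U_den * ev t (\<D> U_num) - ev t (\<D> U_den) * ev t U_num) * y2 t + ev t U_num ^ 3 * y3 t)
      = ev t z3 * S t" if "t \<in> W" for t
  proof -
    define x where "x = U_den * \<D> U_num - \<D> U_den * U_num"
    have xx: "\<D> x = U_den * \<D> (\<D> U_num) - \<D> (\<D> U_den) * U_num" "\<D> (U_num\<^sup>2) = U_num * \<D> U_num + U_num * \<D> U_num"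
      by (simp_all add: x_def derivation_rules power2_eq_square algebra_simps)
    have "((\<lambda>t. 784 * (ev t x * y1 t + ev t (U_num\<^sup>2) * y2 t)) has_field_derivative
        784 * (ev t U_den * ev t (\<D> x) * y1 t + ev t x * y2 t * ev t U_num
         + (ev t U_den * ev t (\<D> (U_num\<^sup>2)) * y2 t + ev t (U_num\<^sup>2) * y3 t * ev t U_num)) / (ev t U_den * E4s t)) (at t)"
      by (rule DERIV_cong[OF DERIV_cmult[OF DERIV_add[OF DERIV_mult[OF dev[OF that] dy(2)[OF that]]
            DERIV_mult[OF dev[OF that] dy(3)[OF that]]]]])
         (use nz[OF that] in \<open>simp add: field_simps\<close>)
    from clear[OF deriv_eq[OF that E2[folded x_def] this dS[OF that]] nz(1,2)[OF that]]
    have *: "21952 * (ev t U_den * ev t (\<D> x) * y1 t + ev t x * y2 t * ev t U_num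
         + (ev t U_den * ev t (\<D> (U_num\<^sup>2)) * y2 t + ev t (U_num\<^sup>2) * y3 t * ev t U_num))
         = ev t (cst 28 * U_den * \<D> z2 + m * z2) * S t"
      by simp
    have "ev t z3 * S t = ev t (cst 28 * U_den * \<D> z2 + m * z2) * S t - 56 * ev t (\<D> U_den) * (ev t z2 * S t)"
      by (simp add: z3_def ode_step_def algebra_simps)
    then show ?thesis
      unfolding * [symmetric] E2[OF that, symmetric] xx unfolding x_def ev_mult ev_arith ev_power
      by (simp add: algebra_simps power2_eq_square power3_eq_cube)
  qed
  have ode_W: "(1 - \<Phi> t) * y3 t + (b1 + b2 - 2 - (a1 + a2 + a3) * \<Phi> t) * y2 t
      + ((b1 - 1) * (b2 - 1) - (a1 * a2 + a1 * a3 + a2 * a3) * \<Phi> t) * y1 t - a1 * a2 * a3 * \<Phi> t * y0 t = 0"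
    (is "?T = 0") if "t \<in> W" for t
  proof -
    have reg: "regular t"
      using W(3)[OF that] B(3) by auto
    define n n1 n2 q q1 q2 E e l where "n = ev t U_den" and "n1 = ev t (\<D> U_den)" and "n2 = ev t (\<D> (\<D> U_den))"
      and "q = ev t U_num" and "q1 = ev t (\<D> U_num)" and "q2 = ev t (\<D> (\<D> U_num))" and "E = ev t cden" and "e = ev t cden_log" and "l = ev t \<Lambda>"
    note defs = n_def n1_def n2_def q_def q1_def q2_def E_def e_def l_def
    define c1 c2 e2 e3 where "c1 = b1 + b2 - 2" and "c2 = (b1 - 1) * (b2 - 1)" and "e2 = a1 * a2 + a1 * a3 + a2 * a3"
      and "e3 = a1 * a2 * a3"
    note defs' = c1_def c2_def e2_def e3_def
    have "ev t (ode_defect (28 * c1) (784 * c2) (784 * e2) (21952 * e3) z z1 z2 z3) * S t = 0"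
      using sol by (simp add: solves_ode_def z1_def z2_def z3_def defs')
    then have D: "ev t z3 * S t + (28 * c1 * q - 42 * e + 84 * n1) * (ev t z2 * S t)
        + (784 * c2 * E - 784 * e2 * (E - q\<^sup>2) + 784 * c1 * (q * n1 - n * q1)
        + 784 * (n * n2 + n1\<^sup>2 - n * l) - 1176 * e * n1) * (ev t z1 * S t)
        - 21952 * e3 * (E - q\<^sup>2) * q * (ev t z * S t) = 0"
      by (simp add: ode_defect_def defs algebra_simps)
    have I: "2 * n * q2 + (2 * n1 - 3 * e) * q1 = 2 * l * q" "e * q - 2 * n * q1 = E - q\<^sup>2"
      using arg_cong[OF U_num_ode, of "ev t"] arg_cong[OF U_num_deriv, of "ev t"] by (simp_all add: defs)
    have P: "E * \<Phi> t = E - q\<^sup>2"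
      using Phi_U_num[OF reg] by (simp add: defs)
    \<comment> \<open>The defect equation is rewritten in y0, ..., y3. Adding multiples of the two
      vanishing relations in \<open>I\<close> removes the derivatives of U and leaves a common
      factor q.\<close>
    have D': "q * (q\<^sup>2 * y3 t + (c1 * E - (c1 + 3/2) * (E - q\<^sup>2)) * y2 t + (c2 * E - e2 * (E - q\<^sup>2)) * y1 t - e3 * (E - q\<^sup>2) * y0 t) = 0"
    proof -
      have "21952 * (q * (q\<^sup>2 * y3 t + (c1 * E - (c1 + 3/2) * (E - q\<^sup>2)) * y2 t + (c2 * E - e2 * (E - q\<^sup>2)) * y1 t - e3 * (E - q\<^sup>2) * y0 t))
        = (21952 * ((n * (n * q2 - n2 * q) - 2 * n1 * (n * q1 - n1 * q)) * y1 t + 3 * q * (n * q1 - n1 * q) * y2 t + q ^ 3 * y3 t)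
          + (28 * c1 * q - 42 * e + 84 * n1) * (784 * ((n * q1 - n1 * q) * y1 t + q\<^sup>2 * y2 t))
          + (784 * c2 * E - 784 * e2 * (E - q\<^sup>2) + 784 * c1 * (q * n1 - n * q1)
        + 784 * (n * n2 + n1\<^sup>2 - n * l) - 1176 * e * n1) * (28 * q * y1 t)
        - 21952 * e3 * (E - q\<^sup>2) * q * y0 t)
        - 10976 * n * (2 * n * q2 + (2 * n1 - 3 * e) * q1 - 2 * l * q) * y1 t
        + 32928 * q * (e * q - 2 * n * q1 - (E - q\<^sup>2)) * y2 t"
        by (simp add: field_simps power2_eq_square power3_eq_cube)
      also have "\<dots> = 0"
        using D I unfolding E0[OF that, symmetric] E1[OF that, symmetric] E2[OF that, symmetric] E3[OF that, symmetric]
          ev_mult ev_arith ev_power defs [symmetric] by simp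
      finally have "21952 * (q * (q\<^sup>2 * y3 t + (c1 * E - (c1 + 3/2) * (E - q\<^sup>2)) * y2 t + (c2 * E - e2 * (E - q\<^sup>2)) * y1 t - e3 * (E - q\<^sup>2) * y0 t)) = 0" .
      then show ?thesis by simp
    qed
    \<comment> \<open>By \<open>ab\<close>, a1 + a2 + a3 = c1 + 3/2; by \<open>P\<close>, E - E
      \<Phi> = q^2. This matches the bracket in \<open>D'\<close>.\<close>
    have "q * E * ?T = q * ((E - E * \<Phi> t) * y3 t + (c1 * E - (c1 + 3/2) * (E * \<Phi> t)) * y2 t
        + (c2 * E - e2 * (E * \<Phi> t)) * y1 t - e3 * (E * \<Phi> t) * y0 t)"
      unfolding ab defs' by (simp add: algebra_simps)
    also have "\<dots> = 0"
      using D' unfolding P by (simp add: algebra_simps)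
    finally show ?thesis
      using nz[OF that] by (simp add: defs)
  qed
  \<comment> \<open>At t = 0 every term vanishes, since each carries a factor \<Phi>(0) = 0.\<close>
  have ode_B: "(1 - \<Phi> t) * y3 t + (b1 + b2 - 2 - (a1 + a2 + a3) * \<Phi> t) * y2 t
      + ((b1 - 1) * (b2 - 1) - (a1 * a2 + a1 * a3 + a2 * a3) * \<Phi> t) * y1 t - a1 * a2 * a3 * \<Phi> t * y0 t = 0"
    if "t \<in> ball 0 \<rho>" for t
    using ode_W[of t] that by (cases "t = 0") (auto simp: W_def y1_def y2_def y3_def Phi_0 \<theta>_def)
  have "f analytic_on {0}"
    using f V by (meson analytic_at)
  moreover have "f 0 = 1"
    using fPhi[OF B(2)] R(2) by (simp add: Phi_0)
  moreover have "\<forall>\<^sub>F x in nhds 0.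
      (1 - x) * \<theta> (\<theta> (\<theta> f)) x + (b1 + b2 - 2 - (a1 + a2 + a3) * x) * \<theta> (\<theta> f) x
      + ((b1 - 1) * (b2 - 1) - (a1 * a2 + a1 * a3 + a2 * a3) * x) * \<theta> f x - a1 * a2 * a3 * x * f x = 0"
  proof -
    \<comment> \<open>Continuity of the inverse carries the equation from a neighbourhood in t to
      one in x = \<Phi>(t).\<close>
    have "isCont g 0"
      using g(1) V holomorphic_on_imp_continuous_on continuous_on_eq_continuous_at by blast
    then have "(g \<longlongrightarrow> 0) (nhds 0)"
      using g(2)[OF B(2)] by (simp add: isCont_def Phi_0 tendsto_nhds_iff)
    then have "\<forall>\<^sub>F x in nhds 0. g x \<in> ball 0 \<rho>"
      using \<rho> by (intro topological_tendstoD) auto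
    moreover have "\<forall>\<^sub>F x in nhds 0. x \<in> V"
      using V by (rule eventually_nhds_in_open)
    ultimately show ?thesis
    proof eventually_elim
      case (elim x)
      then obtain t where t: "t \<in> B" "x = \<Phi> t"
        by (auto simp: V_def)
      with elim g(2) have "t \<in> ball 0 \<rho>" by simp
      from ode_B[OF this] show ?case
        by (simp add: t y0_def y1_def y2_def y3_def)
    qed
  qed
  ultimately have "\<forall>\<^sub>F x in nhds 0. f x = hyp3F2 a1 a2 a3 b1 b2 x"
    using hyp3F2_unique[of f] b unfolding \<theta>_def by blast
  then have "\<forall>\<^sub>F t in nhds 0. f (\<Phi> t) = hyp3F2 a1 a2 a3 b1 b2 (\<Phi> t)"
    using cont by (rule eventually_compose_filterlim)
  moreover have "\<forall>\<^sub>F t in nhds 0. t \<in> B"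
    using B by (intro eventually_nhds_in_open)
  ultimately have "\<forall>\<^sub>F t in nhds 0. hyp3F2 a1 a2 a3 b1 b2 (\<Phi> t) = R t"
    by eventually_elim (simp add: fPhi)
  then show ?thesis
    by (rule eventually_nhds_conv_at[THEN iffD1, THEN conjunct1])
qed

subsection \<open>The three evaluations\<close>

lemma ev_analytic_0: "(\<lambda>t. ev t x) analytic_on {0}"
proof -
  obtain S where S: "open S" "0 \<in> S" "\<And>t. t \<in> S \<Longrightarrow> regular t"
    using eventually_regular by (auto simp: eventually_nhds)
  have "(\<lambda>t. ev t x) holomorphic_on S"
    using S ev_deriv_regular by (auto simp: holomorphic_on_open)
  with S show ?thesis by (auto simp: analytic_at)
qed

lemma ev_0: "ev 0 f5 = 1" "ev 0 f6 = 1" "ev 0 f6t = 1" "ev 0 g5 = 1"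
  by (simp_all add: ev_forms F5_def F6_def F6t_def G5_def E4p_def E4w_def)

lemma coord_0 [simp]: "E4p 0 = 0" "E4w 0 = 0" "E4s 0 = 1"
  by (simp_all add: E4p_def E4w_def E4s_def)

lemma E4s_analytic_0: "E4s analytic_on {0}"
  by (rule E4s_analytic) simp

lemma eventually_radical_deriv:
  "\<forall>\<^sub>F t in at 0. (radical a b c d e k has_field_derivative
     radical a b c d e k t * ev t (radical_num a b c d e (of_nat k)) / (28 * ev t U_den * E4s t)) (at t)"
  using eventually_nhds_conv_at[THEN iffD1, THEN conjunct1, OF eventually_regular]
    eventually_neq_at_within[of 0 0 UNIV]
  by eventually_elim (rule radical_deriv)

lemma of_real_add_of_nat_nonzero:
  fixes k :: nat assumes "0 < x"
  shows "complex_of_real x + of_nat k \<noteq> 0"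
proof -
  have "complex_of_real x + of_nat k = of_real (x + real k)" by simp
  moreover have "x + real k \<noteq> 0" using assms by linarith
  ultimately show ?thesis by (metis of_real_eq_0_iff)
qed

lemma hyp3F2_eval_1:
  "\<forall>\<^sub>F t in at 0. hyp3F2 (-3/28) (11/28) (9/14) (4/7) (6/7) (\<Phi> t)
     = ev t (1 - cst 7 * xw - cst 21 * xp) * ev t (1 - xp) powr (6/7) * ev t f6 powr (3/14)
       / (ev t (1 - xw + cst 3 * xp) * ev t g5 powr (3/7))" (is "\<forall>\<^sub>F t in at 0. _ = ?R t")
proof (rule hypergeometric_pullback[OF _ _ _ eventually_radical_deriv])
  show "?R analytic_on {0}"
    by (intro analytic_intros ev_analytic_0) (auto simp: ev_0)
  show "?R 0 = 1"
    by (simp add: ev_0)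
  show "solves_ode (28 * (4/7 + 6/7 - 2)) (784 * ((4/7 - 1) * (6/7 - 1)))
      (784 * (- 3/28 * (11/28) + - 3/28 * (9/14) + 11/28 * (9/14))) (21952 * (- 3/28 * (11/28) * (9/14)))
      (radical_num (-32) 6 0 (-12) 0 (of_nat 0)) (CP [:1, -32, 7:] [:-6:])"
    using solves_ode_1 by simp
  show "\<forall>\<^sub>F t in at 0. ?R t = ev t (CP [:1, -32, 7:] [:-6:]) * radical (-32) 6 0 (-12) 0 0 t"
    using eventually_nhds_conv_at[THEN iffD1, THEN conjunct1, OF eventually_regular]
  proof eventually_elim
    case (elim t)
    define P Z z where "P = ev t (1 - xp)" and "Z = ev t (1 - cst 7 * xw - cst 21 * xp)"
      and "z = ev t (CP [:1, -32, 7:] [:-6:])"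
    define u v c where "u = ev t (1 + xw + cst 3 * xp)" and "v = ev t (1 - xw + cst 3 * xp)" and "c = ev t (1 + cst 7 * xp)"
    have nz: "P \<noteq> 0" "v \<noteq> 0" "u \<noteq> 0" "c \<noteq> 0" "ev t f5 \<noteq> 0" "ev t f6t \<noteq> 0" "ev t g5 \<noteq> 0"
      using regular_nonzero[OF elim] by (auto simp: P_def v_def u_def c_def)
    \<comment> \<open>Multiplying by the conjugate 1 + w + 3p trades the denominator 1 - w + 3p for
      its norm (1 - p)^2 (1 + 7p); the factor 1 + 7p then cancels.\<close>
    have "(1 - cst 7 * xw - cst 21 * xp) * (1 + xw + cst 3 * xp) = (1 + cst 7 * xp) * CP [:1, -32, 7:] [:-6:]"
      "(1 - xw + cst 3 * xp) * (1 + xw + cst 3 * xp) = (1 - xp)\<^sup>2 * (1 + cst 7 * xp)"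
      by (simp_all add: CP_defs CP_eval)
    then have "Z * u = c * z" "v * u = P\<^sup>2 * c"
      unfolding P_def Z_def z_def u_def v_def c_def by (metis ev_mult ev_power)+
    then have "(Z * P\<^sup>2 - z * v) * (u * c) = 0"
      by algebra
    then have z: "z = Z * P\<^sup>2 / v"
      using nz by (simp add: field_simps)
    have P: "P powr - (8 / 7) = P powr (6/7) / P\<^sup>2"
      using powr_diff[of P "6/7" 2] nz(1) by simp
    have rad: "radical (-32) 6 0 (-12) 0 0 t = P powr - (8/7) * ev t f6 powr (3/14) * ev t g5 powr - (3/7)"
      using nz by (simp add: radical_def P_def)
    show ?case
      unfolding rad P powr_minus[of "ev t g5"] z_def [symmetric] z
      unfolding P_def [symmetric] Z_def [symmetric] v_def [symmetric]
      using nz by (simp add: field_simps)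
  qed
qed (use of_real_add_of_nat_nonzero[of "4/7"] of_real_add_of_nat_nonzero[of "6/7"] in auto)

lemma hyp3F2_eval_2:
  "\<forall>\<^sub>F t in at 0. hyp3F2 (1/28) (15/28) (11/14) (5/7) (8/7) (\<Phi> t)
     = ev t (1 - cst (7/3) * xp) * ev t (1 - xp) powr (2/7) * ev t f6t powr (1/14) * ev t g5 powr (1/7)
       / ev t f5" (is "\<forall>\<^sub>F t in at 0. _ = ?R t")
proof (rule hypergeometric_pullback)
  show "?R analytic_on {0}"
    by (intro analytic_intros ev_analytic_0) (auto simp: ev_0)
  show "?R 0 = 1"
    by (simp add: ev_0)
  show "solves_ode (28 * (5/7 + 8/7 - 2)) (784 * ((5/7 - 1) * (8/7 - 1)))
      (784 * (1/28 * (15/28) + 1/28 * (11/14) + 15/28 * (11/14))) (21952 * (1/28 * (15/28) * (11/14)))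
      (radical_num 8 0 2 4 (-28) (of_nat 0)) (CP [:3, -7:] 0)"
    using solves_ode_2 by simp
  \<comment> \<open>The integral form 3 - 7p is three times the prefactor 1 - 7p/3; dividing the
    radical by 3 leaves its logarithmic derivative unchanged.\<close>
  show "\<forall>\<^sub>F t in at 0. ((\<lambda>t. radical 8 0 2 4 (-28) 0 t / 3) has_field_derivative
     radical 8 0 2 4 (-28) 0 t / 3 * ev t (radical_num 8 0 2 4 (-28) (of_nat 0)) / (28 * ev t U_den * E4s t)) (at t)"
    using eventually_radical_deriv[of 8 0 2 4 "-28" 0]
    by eventually_elim (drule DERIV_cdivide[of _ _ _ _ 3], simp)
  show "\<forall>\<^sub>F t in at 0. ?R t = ev t (CP [:3, -7:] 0) * (radical 8 0 2 4 (-28) 0 t / 3)"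
    using eventually_nhds_conv_at[THEN iffD1, THEN conjunct1, OF eventually_regular]
  proof eventually_elim
    case (elim t)
    have z: "ev t (CP [:3, -7:] 0) = 3 * ev t (1 - cst (7/3) * xp)"
      by (simp add: ev_def CP_defs CP_arith)
    have rad: "radical 8 0 2 4 (-28) 0 t
        = ev t (1 - xp) powr (2/7) * ev t f6t powr (1/14) * ev t g5 powr (1/7) * ev t f5 powr - 1"
      using regular_nonzero[OF elim] by (simp add: radical_def)
    have F: "ev t f5 powr - 1 = inverse (ev t f5)"
      using powr_minus[of "ev t f5" 1] by simp
    show ?case
      unfolding rad z F using regular_nonzero(2)[OF elim] by (simp add: field_simps)
  qed
qed (use of_real_add_of_nat_nonzero[of "5/7"] of_real_add_of_nat_nonzero[of "8/7"] in auto)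

text \<open>Since w - 4p = t(s - 4t), the quotient t/(w - 4p) is written as 1/(s - 4t), which is
  holomorphic at 0 with value 1.\<close>

lemma hyp3F2_eval_3:
  "\<forall>\<^sub>F t in at 0. hyp3F2 (9/28) (23/28) (15/14) (9/7) (10/7) (\<Phi> t)
     = ev t (1 + cst 7 * xw - cst 21 * xp) * ev t (1 - xp) powr (4/7) * ev t f6t powr (1/7) * ev t g5 powr (9/7)
       / ((E4s t - 4 * t) * ev t f5 ^ 3)" (is "\<forall>\<^sub>F t in at 0. _ = ?R t")
proof (rule hypergeometric_pullback[OF _ _ _ eventually_radical_deriv])
  show "?R analytic_on {0}"
    by (intro analytic_intros ev_analytic_0 E4s_analytic_0) (auto simp: ev_0)
  show "?R 0 = 1"
    by (simp add: ev_0)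
  show "solves_ode (28 * (9/7 + 10/7 - 2)) (784 * ((9/7 - 1) * (10/7 - 1)))
      (784 * (9/28 * (23/28) + 9/28 * (15/14) + 23/28 * (15/14))) (21952 * (9/28 * (23/28) * (15/14)))
      (radical_num (-12) 0 4 36 (-84) (of_nat 1)) (CP [:0, 11, -7:] [:1:])"
    using solves_ode_3 by simp
  show "\<forall>\<^sub>F t in at 0. ?R t = ev t (CP [:0, 11, -7:] [:1:]) * radical (-12) 0 4 36 (-84) 1 t"
    using eventually_nhds_conv_at[THEN iffD1, THEN conjunct1, OF eventually_regular]
      eventually_neq_at_within[of 0 0 UNIV]
  proof eventually_elim
    case (elim t)
    define P Z z where "P = ev t (1 - xp)" and "Z = ev t (1 + cst 7 * xw - cst 21 * xp)"
      and "z = ev t (CP [:0, 11, -7:] [:1:])"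
    define u v c where "u = ev t (xw + cst 4 * xp)" and "v = E4s t - 4 * t" and "c = ev t (1 + cst 7 * xp)"
    have nz: "P \<noteq> 0" "v \<noteq> 0" "c \<noteq> 0" "ev t f5 \<noteq> 0" "ev t f6 \<noteq> 0" "ev t g5 \<noteq> 0"
      using regular_nonzero[OF elim(1)] by (auto simp: P_def v_def c_def)
    \<comment> \<open>The factor w + 4p plays the conjugate role: the norm w^2 - 16p^2 is p(1 - p)(1
      + 7p).\<close>
    have "(1 + cst 7 * xw - cst 21 * xp) * (xw + cst 4 * xp) = (1 + cst 7 * xp) * CP [:0, 11, -7:] [:1:]"
      "(xw - cst 4 * xp) * (xw + cst 4 * xp) = xp * (1 - xp) * (1 + cst 7 * xp)"
      by (simp_all add: CP_defs CP_eval)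
    moreover have v: "ev t (xw - cst 4 * xp) = t * v"
      by (simp add: E4w_eq E4p_def v_def power2_eq_square algebra_simps)
    ultimately have "Z * u = c * z" and uv: "t * v * u = t\<^sup>2 * P * c"
      unfolding P_def Z_def z_def u_def c_def v[symmetric] by (metis ev_mult E4p_def ev_coord(1))+
    have "u \<noteq> 0"
      using uv nz elim(2) by auto
    have "(Z * t * P - z * v) * (u * c * t) = 0"
      using \<open>Z * u = c * z\<close> uv by algebra
    then have z: "z = Z * t * P / v"
      using nz \<open>u \<noteq> 0\<close> elim(2) by (simp add: field_simps)
    have P: "P powr - (3 / 7) = P powr (4/7) / P"
      using powr_diff[of P "4/7" 1] nz(1) by simp
    have F: "ev t f5 powr - 3 = inverse (ev t f5 ^ 3)"
      using powr_minus[of "ev t f5" 3] nz by simp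
    have rad: "radical (-12) 0 4 36 (-84) 1 t
        = P powr - (3/7) * ev t f6t powr (1/7) * ev t g5 powr (9/7) * ev t f5 powr - 3 / t"
      using nz by (simp add: radical_def P_def)
    show ?case
      unfolding rad P F z_def [symmetric] z
      unfolding P_def [symmetric] Z_def [symmetric] v_def [symmetric]
      using nz elim(2) by (simp add: field_simps)
  qed
qed (use of_real_add_of_nat_nonzero[of "9/7"] of_real_add_of_nat_nonzero[of "10/7"] in auto)

text \<open>The point t = 0 is excluded because the third quotient is 0/0 there, read as 0, while
  its holomorphic continuation has value 1. Principal powers are the right branches, as every base
  equals 1 at t = 0.\<close>

theorem mainTheorem19:
  shows "\<forall>\<^sub>F t in at (0::complex).
    (let p = E4p t; w = E4w t in
      hyp3F2 (-3/28) (11/28) (9/14) (4/7) (6/7) (Phi4 p w)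
        = (1 - 7*w - 21*p) * (1 - p) powr (6/7) * F6 p w powr (3/14)
          / ((1 - w + 3*p) * G5 p w powr (3/7))
    \<and> hyp3F2 (1/28) (15/28) (11/14) (5/7) (8/7) (Phi4 p w)
        = (1 - 7/3*p) * (1 - p) powr (2/7) * F6t p w powr (1/14) * G5 p w powr (1/7)
          / F5 p w
    \<and> hyp3F2 (9/28) (23/28) (15/14) (9/7) (10/7) (Phi4 p w)
        = (1 + 7*w - 21*p) * t * (1 - p) powr (4/7) * F6t p w powr (1/7) * G5 p w powr (9/7)
          / ((w - 4*p) * F5 p w ^ 3))"
  using hyp3F2_eval_1 hyp3F2_eval_2 hyp3F2_eval_3 eventually_neq_at_within[of 0 0 UNIV]
proof eventually_elim
  case (elim t)
  have w: "E4w t - 4 * E4p t = t * (E4s t - 4 * t)"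
    by (simp add: E4w_eq E4p_def power2_eq_square algebra_simps)
  show ?case
    using elim unfolding Let_def w by (simp add: ev_forms \<Phi>_def)
qed

end
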